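(* For every $\varepsilon>0$ the following holds. Let $r\geq2$ and let $F$ be an $r$-graph without isolated vertices, and let $\ell:=\ell(F)$. For the class consisting of all input $r$-graphs $G$ on $n$ vertices with average degree $d$ and maximum degree $\Delta$, there exists an $\varepsilon$-tester for $F$-freeness with \[O_\varepsilon\left(\max\left\{\left(n/(nd)^{1/v_F}\right)^{r},\left(n^{\ell-2}\Delta/d\right)^{r/(\ell-1)}\right\}\right)\] queries.
   Context: $v_F$ is the number of vertices of $F$. The vertex-overlap index $\ell(F)$ is the minimum integer $\ell$ such that any two $r$-graphs isomorphic to $F$ sharing $\ell$ vertices must share at least one edge; if no $\ell\in[v_F]$ has this property, $\ell(F):=v_F+1$. Testing model: the input $r$-graph $G$ with $m$ edges has a fixed ordering of the edges at each vertex; queries are vertex-set queries (is a given $r$-set an edge?) and neighbour queries (the $i$-th edge at vertex $v$). $G$ is $\varepsilon$-far from $F$-free if at least $\varepsilon m$ edges must be added or deleted to make it contain no copy of $F$. A tester accepts $F$-free inputs with probability $\ge2/3$ and rejects far inputs with probability $\ge2/3$; an $\varepsilon$-tester is a tester valid for all distance parameters $\varepsilon'\ge\varepsilon$. $O_\varepsilon$ means the implicit constant may depend on $\varepsilon$ (and $F$) but not on $n$, $d$, $\Delta$. *)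

theory Defs
  imports "HOL-Probability.Probability"
begin

text \<open>An r-graph is represented by its edge set, a set of r-element sets of vertices (naturals).
  A host graph on n vertices has vertex set {..<n}. A pattern F without isolated vertices has
  vertex set the union of its edges.\<close>

definition is_rgraph :: "nat \<Rightarrow> nat set set \<Rightarrow> bool" where
  "is_rgraph r F \<longleftrightarrow> finite F \<and> (\<forall>e\<in>F. card e = r)"

definition rgraph_on :: "nat \<Rightarrow> nat \<Rightarrow> nat set set \<Rightarrow> bool" where
  "rgraph_on r n G \<longleftrightarrow> (\<forall>e\<in>G. card e = r \<and> e \<subseteq> {..<n})"

definition verts :: "nat set set \<Rightarrow> nat set" where
  "verts F = \<Union>F"

definition vF :: "nat set set \<Rightarrow> nat" where
  "vF F = card (verts F)"

definition contains_copy :: "nat set set \<Rightarrow> nat set set \<Rightarrow> bool" where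
  "contains_copy F G \<longleftrightarrow> (\<exists>\<phi>::nat\<Rightarrow>nat. inj_on \<phi> (verts F) \<and> (\<forall>e\<in>F. \<phi> ` e \<in> G))"

definition F_free :: "nat set set \<Rightarrow> nat set set \<Rightarrow> bool" where
  "F_free F G \<longleftrightarrow> \<not> contains_copy F G"

definition overlap_prop :: "nat set set \<Rightarrow> nat \<Rightarrow> bool" where
  "overlap_prop F l \<longleftrightarrow>
     (\<forall>\<phi> \<psi> :: nat \<Rightarrow> nat. inj_on \<phi> (verts F) \<longrightarrow> inj_on \<psi> (verts F) \<longrightarrow>
        card (\<phi> ` verts F \<inter> \<psi> ` verts F) \<ge> l \<longrightarrow>
        (\<exists>e\<in>F. \<exists>e'\<in>F. \<phi> ` e = \<psi> ` e'))"

definition overlap_index :: "nat set set \<Rightarrow> nat" where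
  "overlap_index F =
     (if \<exists>l\<in>{1..vF F}. overlap_prop F l
      then (LEAST l. l \<in> {1..vF F} \<and> overlap_prop F l)
      else vF F + 1)"

definition vdeg :: "nat set set \<Rightarrow> nat \<Rightarrow> nat" where
  "vdeg G v = card {e\<in>G. v \<in> e}"

definition avg_degree :: "nat \<Rightarrow> nat \<Rightarrow> nat set set \<Rightarrow> real" where
  "avg_degree r n G = real r * real (card G) / real n"

definition max_degree :: "nat \<Rightarrow> nat set set \<Rightarrow> nat" where
  "max_degree n G = Max (insert 0 (vdeg G ` {..<n}))"

definition dist_free :: "nat \<Rightarrow> nat \<Rightarrow> nat set set \<Rightarrow> nat set set \<Rightarrow> nat" where
  "dist_free r n F G = (LEAST k. \<exists>H. rgraph_on r n H \<and> F_free F H \<and> card (G - H \<union> (H - G)) = k)"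

definition eps_far :: "nat \<Rightarrow> nat \<Rightarrow> nat set set \<Rightarrow> real \<Rightarrow> nat set set \<Rightarrow> bool" where
  "eps_far r n F \<epsilon> G \<longleftrightarrow> real (dist_free r n F G) \<ge> \<epsilon> * real (card G)"

definition valid_ordering :: "nat \<Rightarrow> nat set set \<Rightarrow> (nat \<Rightarrow> nat \<Rightarrow> nat set option) \<Rightarrow> bool" where
  "valid_ordering n G ord \<longleftrightarrow>
     (\<forall>v. (\<forall>i. i \<ge> vdeg G v \<longrightarrow> ord v i = None) \<and>
          (\<forall>i < vdeg G v. \<exists>e. ord v i = Some e \<and> e \<in> G \<and> v \<in> e) \<and>
          inj_on (ord v) {..<vdeg G v})"

text \<open>Deterministic adaptive query algorithms (decision trees): a vertex-set query asks whether
  a given set is an edge; a neighbour query asks for the i-th edge at vertex v.\<close>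
datatype qalg = Accept | Reject
  | VQuery "nat set" "bool \<Rightarrow> qalg"
  | NQuery nat nat "nat set option \<Rightarrow> qalg"

primrec run :: "qalg \<Rightarrow> nat set set \<Rightarrow> (nat \<Rightarrow> nat \<Rightarrow> nat set option) \<Rightarrow> bool" where
  "run Accept G ord = True"
| "run Reject G ord = False"
| "run (VQuery S k) G ord = run (k (S \<in> G)) G ord"
| "run (NQuery v i k) G ord = run (k (ord v i)) G ord"

primrec nqueries :: "qalg \<Rightarrow> nat set set \<Rightarrow> (nat \<Rightarrow> nat \<Rightarrow> nat set option) \<Rightarrow> nat" where
  "nqueries Accept G ord = 0"
| "nqueries Reject G ord = 0"
| "nqueries (VQuery S k) G ord = Suc (nqueries (k (S \<in> G)) G ord)"
| "nqueries (NQuery v i k) G ord = Suc (nqueries (k (ord v i)) G ord)"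

text \<open>A randomized tester is a probability distribution over deterministic algorithms.\<close>
definition accept_prob :: "qalg pmf \<Rightarrow> nat set set \<Rightarrow> (nat \<Rightarrow> nat \<Rightarrow> nat set option) \<Rightarrow> real" where
  "accept_prob T G ord = measure_pmf.prob T {A. run A G ord}"

definition in_class :: "nat \<Rightarrow> nat \<Rightarrow> real \<Rightarrow> nat \<Rightarrow> nat set set \<Rightarrow> (nat \<Rightarrow> nat \<Rightarrow> nat set option) \<Rightarrow> bool" where
  "in_class r n d \<Delta> G ord \<longleftrightarrow> rgraph_on r n G \<and> avg_degree r n G = d \<and>
     max_degree n G = \<Delta> \<and> valid_ordering n G ord"

definition eps_tester :: "nat \<Rightarrow> nat set set \<Rightarrow> real \<Rightarrow> nat \<Rightarrow> real \<Rightarrow> nat \<Rightarrow> qalg pmf \<Rightarrow> bool" where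
  "eps_tester r F \<epsilon> n d \<Delta> T \<longleftrightarrow>
     (\<forall>G ord. in_class r n d \<Delta> G ord \<longrightarrow>
        (F_free F G \<longrightarrow> accept_prob T G ord \<ge> 2/3) \<and>
        (\<forall>\<epsilon>'\<ge>\<epsilon>. eps_far r n F \<epsilon>' G \<longrightarrow> 1 - accept_prob T G ord \<ge> 2/3))"

definition query_bounded :: "nat \<Rightarrow> nat \<Rightarrow> real \<Rightarrow> nat \<Rightarrow> qalg pmf \<Rightarrow> real \<Rightarrow> bool" where
  "query_bounded r n d \<Delta> T q \<longleftrightarrow>
     (\<forall>A\<in>set_pmf T. \<forall>G ord. in_class r n d \<Delta> G ord \<longrightarrow> real (nqueries A G ord) \<le> q)"

end

theory Submission
  imports Defs
begin

text \<open>The tester samples every vertex independently with probability \<open>p\<close>, queries all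
  \<open>r\<close>-sets inside the sample and rejects iff it sees a copy of \<open>F\<close>. If \<open>G\<close> is far from
  \<open>F\<close>-free, a maximal family of pairwise edge-disjoint copies has \<open>N = \<Omega>(nd)\<close> members. Two of
  them share at most \<open>\<ell> - 1\<close> vertices, and every one of them meets at most \<open>v\<^sub>F \<Delta>\<close> others.
  By the second moment method some copy in the family is sampled with high probability as soon as
  \<open>N p ^ v\<^sub>F\<close> and \<open>N p ^ (\<ell> - 1) / \<Delta>\<close> are large, and the two terms of the maximum are the values
  of \<open>(n p) ^ r\<close> at these two thresholds. A sample much larger than its mean is
  discarded by accepting, which turns the expected number of queries into a worst-case bound.\<close>

section \<open>The second moment method\<close>

text \<open>Chebyshev's inequality for the number \<open>X\<close> of events that occur: if none
  occurs, \<open>X\<close> lies a full mean below its expectation. The right-hand side is the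
  variance of \<open>X\<close> over its squared mean.\<close>

lemma prob_no_event_le:
  fixes M :: "'a pmf" and A :: "'i \<Rightarrow> 'a set"
  assumes "finite I" and pos: "(\<Sum>i\<in>I. measure_pmf.prob M (A i)) > 0"
  shows "measure_pmf.prob M {x. \<forall>i\<in>I. x \<notin> A i} \<le>
    (\<Sum>i\<in>I. \<Sum>j\<in>I. measure_pmf.prob M (A i \<inter> A j)) / (\<Sum>i\<in>I. measure_pmf.prob M (A i))\<^sup>2 - 1"
proof -
  define X :: "'a \<Rightarrow> real" where "X = (\<lambda>x. \<Sum>i\<in>I. indicator (A i) x)"
  define \<mu> where "\<mu> = (\<Sum>i\<in>I. measure_pmf.prob M (A i))"
  have X2: "(X x)\<^sup>2 = (\<Sum>i\<in>I. \<Sum>j\<in>I. indicator (A i \<inter> A j) x)" for x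
    by (simp add: X_def power2_eq_square sum_product indicator_inter_arith)
  have ind: "integrable (measure_pmf M) (indicator B :: 'a \<Rightarrow> real)" for B
    by (intro measure_pmf.integrable_const_bound[where B = 1]) (auto simp: indicator_def)
  have int: "integrable (measure_pmf M) X" "integrable (measure_pmf M) (\<lambda>x. (X x)\<^sup>2)"
    unfolding X2 unfolding X_def by (intro Bochner_Integration.integrable_sum ind)+
  have EX: "measure_pmf.expectation M X = \<mu>"
    unfolding X_def \<mu>_def by (subst Bochner_Integration.integral_sum) (auto intro: ind)
  have EX2: "measure_pmf.expectation M (\<lambda>x. (X x)\<^sup>2) =
      (\<Sum>i\<in>I. \<Sum>j\<in>I. measure_pmf.prob M (A i \<inter> A j))"
    unfolding X2 by (subst Bochner_Integration.integral_sum
        | auto intro!: ind Bochner_Integration.integrable_sum sum.cong)+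
  have "measure_pmf.prob M {x. \<forall>i\<in>I. x \<notin> A i} \<le>
      measure_pmf.prob M {x \<in> space M. \<mu> \<le> \<bar>X x - measure_pmf.expectation M X\<bar>}"
  proof (intro measure_pmf.finite_measure_mono subsetI)
    fix x assume "x \<in> {x. \<forall>i\<in>I. x \<notin> A i}"
    then have "X x = 0" by (simp add: X_def)
    then show "x \<in> {x \<in> space M. \<mu> \<le> \<bar>X x - measure_pmf.expectation M X\<bar>}"
      by (simp add: EX)
  qed auto
  also have "\<dots> \<le> measure_pmf.variance M X / \<mu>\<^sup>2"
    using int pos by (intro measure_pmf.Chebyshev_inequality) (auto simp: \<mu>_def)
  also have "measure_pmf.variance M X = (\<Sum>i\<in>I. \<Sum>j\<in>I. measure_pmf.prob M (A i \<inter> A j)) - \<mu>\<^sup>2"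
    using int by (subst measure_pmf.variance_eq) (auto simp: EX EX2)
  also have "\<dots> / \<mu>\<^sup>2 = (\<Sum>i\<in>I. \<Sum>j\<in>I. measure_pmf.prob M (A i \<inter> A j)) / \<mu>\<^sup>2 - 1"
    using pos by (simp add: diff_divide_distrib \<mu>_def)
  finally show ?thesis by (simp add: \<mu>_def)
qed

section \<open>Binomial random subsets\<close>

definition random_subset :: "'a set \<Rightarrow> real \<Rightarrow> 'a set pmf" where
  "random_subset V p = map_pmf (\<lambda>f. {x\<in>V. f x}) (Pi_pmf V False (\<lambda>_. bernoulli_pmf p))"

lemma prob_random_subset_superset:
  assumes "finite V" "T \<subseteq> V" "0 \<le> p" "p \<le> 1"
  shows "measure_pmf.prob (random_subset V p) {S. T \<subseteq> S} = p ^ card T"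
proof -
  \<comment> \<open>Written as a product event, so that independence turns its probability into a
    product over \<open>V\<close>.\<close>
  have eq: "(\<lambda>f. {x\<in>V. f x}) -` {S. T \<subseteq> S} = Pi V (\<lambda>x. if x \<in> T then {True} else UNIV)"
    using assms(2) by (fastforce simp: Pi_iff split: if_splits)
  have "measure_pmf.prob (random_subset V p) {S. T \<subseteq> S} =
      (\<Prod>x\<in>V. measure_pmf.prob (bernoulli_pmf p) (if x \<in> T then {True} else UNIV))"
    unfolding random_subset_def measure_map_pmf eq using assms(1) by (rule measure_Pi_pmf_Pi)
  also have "\<dots> = (\<Prod>x\<in>V. if x \<in> T then p else 1)"
    using assms(3,4) by (intro prod.cong) (auto simp: measure_pmf_single)
  also have "\<dots> = p ^ card T"
    using assms(1,2) by (simp add: prod.If_cases Int_absorb1)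
  finally show ?thesis .
qed

lemma set_pmf_random_subset:
  "S \<in> set_pmf (random_subset V p) \<Longrightarrow> S \<subseteq> V"
  by (auto simp: random_subset_def)

lemma finite_random_subset:
  "finite V \<Longrightarrow> S \<in> set_pmf (random_subset V p) \<Longrightarrow> finite S"
  using set_pmf_random_subset by (rule finite_subset)

text \<open>Markov's inequality; the mean \<open>card V * p\<close> comes from linearity of
  expectation.\<close>

lemma prob_random_subset_card_ge:
  assumes "finite V" "0 \<le> p" "p \<le> 1" "t > 0"
  shows "measure_pmf.prob (random_subset V p) {S. t \<le> real (card S)} \<le> real (card V) * p / t"
proof -
  let ?M = "random_subset V p"
  have fin: "finite (set_pmf ?M)"
  proof (rule finite_subset)
    show "set_pmf ?M \<subseteq> Pow V" by (auto dest: set_pmf_random_subset)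
  qed (use assms(1) in simp)
  have "measure_pmf.prob ?M {S \<in> space ?M. t \<le> real (card S)} \<le>
      measure_pmf.expectation ?M (\<lambda>S. real (card S)) / t"
    using assms by (intro integral_Markov_inequality_measure[where A = "{}"])
      (auto intro: integrable_measure_pmf_finite fin)
  also have "measure_pmf.expectation ?M (\<lambda>S. real (card S)) =
      measure_pmf.expectation ?M (\<lambda>S. \<Sum>x\<in>V. indicator {S. {x} \<subseteq> S} S)"
  \<comment> \<open>The integrands agree only on subsets of \<open>V\<close>, hence almost
    surely.\<close>
  proof (intro integral_cong_AE)
    show "AE S in ?M. real (card S) = (\<Sum>x\<in>V. indicator {S. {x} \<subseteq> S} S)"
    proof (intro AE_pmfI)
      fix S assume "S \<in> set_pmf ?M"
      then have "S \<subseteq> V" by (rule set_pmf_random_subset)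
      then show "real (card S) = (\<Sum>x\<in>V. indicator {S. {x} \<subseteq> S} S)"
        using assms(1) by (simp add: indicator_def sum.If_cases Int_absorb1)
    qed
  qed auto
  also have "\<dots> = (\<Sum>x\<in>V. measure_pmf.prob ?M {S. {x} \<subseteq> S})"
    by (subst Bochner_Integration.integral_sum) (auto intro: integrable_measure_pmf_finite fin)
  also have "\<dots> = (\<Sum>x\<in>V. p)"
  proof (intro sum.cong refl)
    fix x assume "x \<in> V"
    then show "measure_pmf.prob ?M {S. {x} \<subseteq> S} = p"
      using prob_random_subset_superset[of V "{x}" p] assms by simp
  qed
  finally show ?thesis by simp
qed

text \<open>Of the ordered pairs of sets, the diagonal contributes at most \<open>N p ^ k\<close> to
  the second moment, the intersecting pairs at most \<open>N D p ^ (2 k - s)\<close>, and the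
  disjoint ones at most \<open>N\<^sup>2 p ^ (2 k)\<close>, where \<open>N = card I\<close>. Divided
  by the squared mean, the first two give the two fractions and the third cancels the
  \<open>- 1\<close>.\<close>

lemma prob_random_subset_contains_none:
  fixes W :: "'i \<Rightarrow> 'a set"
  assumes "finite V" "finite I" "I \<noteq> {}" "0 < p" "p \<le> 1"
    and W: "\<And>i. i \<in> I \<Longrightarrow> W i \<subseteq> V" "\<And>i. i \<in> I \<Longrightarrow> card (W i) = k"
    and s: "\<And>i j. i \<in> I \<Longrightarrow> j \<in> I \<Longrightarrow> i \<noteq> j \<Longrightarrow> card (W i \<inter> W j) \<le> s" "s \<le> k"
    and D: "\<And>i. i \<in> I \<Longrightarrow> card {j\<in>I. W i \<inter> W j \<noteq> {}} \<le> D"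
  shows "measure_pmf.prob (random_subset V p) {S. \<forall>i\<in>I. \<not> W i \<subseteq> S} \<le>
    1 / (real (card I) * p ^ k) + real D / (real (card I) * p ^ s)"
proof -
  let ?M = "random_subset V p"
  let ?A = "\<lambda>i. {S. W i \<subseteq> S}"
  let ?N = "real (card I)"
  have N: "?N > 0" using assms(2,3) by (simp add: card_gt_0_iff)
  have pA: "measure_pmf.prob ?M (?A i) = p ^ k" if "i \<in> I" for i
    using prob_random_subset_superset[of V "W i" p] that W assms by simp
  have sumA: "(\<Sum>i\<in>I. measure_pmf.prob ?M (?A i)) = ?N * p ^ k"
    using pA by simp
  \<comment> \<open>A sum of three nonnegative terms covers all cases at once, and each term can be
    summed over \<open>j\<close> separately.\<close>
  have pAA: "measure_pmf.prob ?M (?A i \<inter> ?A j) \<le> (if i = j then p ^ k else 0) +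
      (if W i \<inter> W j \<noteq> {} then p ^ (2 * k - s) else 0) + p ^ (2 * k)"
    if ij: "i \<in> I" "j \<in> I" for i j
  proof -
    have "?A i \<inter> ?A j = {S. W i \<union> W j \<subseteq> S}" by auto
    then have prob: "measure_pmf.prob ?M (?A i \<inter> ?A j) = p ^ card (W i \<union> W j)"
      using prob_random_subset_superset[of V "W i \<union> W j" p] W ij assms by simp
    have fin: "finite (W i)" "finite (W j)"
      using W(1) ij assms(1) finite_subset by blast+
    have U: "card (W i \<union> W j) + card (W i \<inter> W j) = 2 * k"
      using card_Un_Int[OF fin] W(2) ij by simp
    consider "i = j" | "i \<noteq> j" "W i \<inter> W j = {}" | "i \<noteq> j" "W i \<inter> W j \<noteq> {}" by blast
    then show ?thesis
    proof cases
      case 1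
      then show ?thesis using prob W(2) ij assms(4) by simp
    next
      case 2
      then show ?thesis using prob U assms(4) by simp
    next
      case 3
      then have "2 * k - s \<le> card (W i \<union> W j)" using s(1)[OF ij] U by linarith
      then have "p ^ card (W i \<union> W j) \<le> p ^ (2 * k - s)"
        using assms(4,5) by (intro power_decreasing) auto
      moreover have "0 \<le> p ^ (2 * k)" using assms(4) by simp
      ultimately have "p ^ card (W i \<union> W j) \<le> p ^ (2 * k - s) + p ^ (2 * k)" by linarith
      then show ?thesis using prob 3 by simp
    qed
  qed
  have row: "(\<Sum>j\<in>I. measure_pmf.prob ?M (?A i \<inter> ?A j)) \<le>
      p ^ k + D * p ^ (2 * k - s) + ?N * p ^ (2 * k)" if i: "i \<in> I" for i
  proof -
    have "(\<Sum>j\<in>I. measure_pmf.prob ?M (?A i \<inter> ?A j)) \<le>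
        (\<Sum>j\<in>I. (if i = j then p ^ k else 0) +
          (if W i \<inter> W j \<noteq> {} then p ^ (2 * k - s) else 0) + p ^ (2 * k))"
      using i by (intro sum_mono pAA)
    also have "\<dots> = p ^ k + card {j\<in>I. W i \<inter> W j \<noteq> {}} * p ^ (2 * k - s) + ?N * p ^ (2 * k)"
      using assms(2) i by (simp add: sum.distrib sum.If_cases Int_def)
    also have "\<dots> \<le> p ^ k + D * p ^ (2 * k - s) + ?N * p ^ (2 * k)"
      using D[OF i] assms(4) by (intro add_mono mult_right_mono) auto
    finally show ?thesis .
  qed
  \<comment> \<open>The natural-number subtraction is exact because
    \<open>s \<le> k\<close>.\<close>
  have pk: "p ^ (2 * k) = p ^ (2 * k - s) * p ^ s" "p ^ (2 * k) = p ^ k * p ^ k"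
    using s(2) by (simp_all flip: power_add add: mult_2)
  have "(\<Sum>i\<in>I. \<Sum>j\<in>I. measure_pmf.prob ?M (?A i \<inter> ?A j)) \<le>
      (\<Sum>i\<in>I. p ^ k + D * p ^ (2 * k - s) + ?N * p ^ (2 * k))"
    by (intro sum_mono row)
  also have "\<dots> = ?N * (p ^ k + D * p ^ (2 * k - s) + ?N * p ^ (2 * k))" by simp
  finally have total: "(\<Sum>i\<in>I. \<Sum>j\<in>I. measure_pmf.prob ?M (?A i \<inter> ?A j)) \<le> \<dots>" .
  have "measure_pmf.prob ?M {S. \<forall>i\<in>I. S \<notin> ?A i} \<le>
      (\<Sum>i\<in>I. \<Sum>j\<in>I. measure_pmf.prob ?M (?A i \<inter> ?A j)) / (?N * p ^ k)\<^sup>2 - 1"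
    using prob_no_event_le[of I ?M ?A] assms(2,4) N unfolding sumA by simp
  also have "\<dots> \<le> ?N * (p ^ k + D * p ^ (2 * k - s) + ?N * p ^ (2 * k)) / (?N * p ^ k)\<^sup>2 - 1"
    using total by (intro diff_right_mono divide_right_mono) auto
  also have "?N * (p ^ k + D * p ^ (2 * k - s) + ?N * p ^ (2 * k)) =
      ?N * p ^ k + ?N * (D * p ^ (2 * k - s)) + (?N * p ^ k)\<^sup>2"
    unfolding pk(2) by (simp add: algebra_simps power2_eq_square)
  also have "\<dots> / (?N * p ^ k)\<^sup>2 - 1 =
      ?N * p ^ k / (?N * p ^ k)\<^sup>2 + ?N * (D * p ^ (2 * k - s)) / (?N * p ^ k)\<^sup>2"
    using N assms(4) by (simp add: add_divide_distrib)
  also have "(?N * p ^ k)\<^sup>2 = ?N\<^sup>2 * (p ^ (2 * k - s) * p ^ s)"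
    unfolding pk(1)[symmetric] pk(2) by (simp add: power2_eq_square mult_ac)
  also have "?N * (D * p ^ (2 * k - s)) / \<dots> = D / (?N * p ^ s)"
    using N assms(4) by (simp add: power2_eq_square)
  also have "?N * p ^ k / (?N\<^sup>2 * (p ^ (2 * k - s) * p ^ s)) = 1 / (?N * p ^ k)"
    unfolding pk(1)[symmetric] pk(2) using N assms(4) by (simp add: power2_eq_square)
  finally show ?thesis by simp
qed

section \<open>Edge-disjoint copies\<close>

text \<open>A copy is its edge set alone: without isolated vertices, \<open>verts\<close> recovers
  the vertices, and edge-disjointness is plain disjointness.\<close>

definition is_copy :: "nat set set \<Rightarrow> nat set set \<Rightarrow> bool" where
  "is_copy F C \<longleftrightarrow> (\<exists>\<phi>. inj_on \<phi> (verts F) \<and> C = (`) \<phi> ` F)"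

lemma contains_copy_iff: "contains_copy F G \<longleftrightarrow> (\<exists>C\<subseteq>G. is_copy F C)"
proof -
  have "(\<forall>e\<in>F. \<phi> ` e \<in> G) \<longleftrightarrow> (`) \<phi> ` F \<subseteq> G" for \<phi> by (simp add: image_subset_iff)
  then show ?thesis unfolding contains_copy_def is_copy_def by metis
qed

lemma finite_verts: "is_rgraph r F \<Longrightarrow> r > 0 \<Longrightarrow> finite (verts F)"
  unfolding is_rgraph_def verts_def by (metis card_ge_0_finite finite_Union)

lemma verts_image: "verts ((`) \<phi> ` F) = \<phi> ` verts F"
  by (auto simp: verts_def)

lemma card_verts_copy: "is_copy F C \<Longrightarrow> card (verts C) = vF F"
  by (auto simp: is_copy_def verts_image vF_def card_image)

lemma rgraph_on_finite: "rgraph_on r n G \<Longrightarrow> finite G"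
  by (rule finite_subset[of _ "Pow {..<n}"]) (auto simp: rgraph_on_def)

section \<open>The overlap index and its effect on edge-disjoint copies\<close>

lemma overlap_index_cases:
  obtains "overlap_index F \<in> {1..vF F}" "overlap_prop F (overlap_index F)"
    | "overlap_index F = vF F + 1"
proof (cases "\<exists>l\<in>{1..vF F}. overlap_prop F l")
  case True
  then have "overlap_index F = (LEAST l. l \<in> {1..vF F} \<and> overlap_prop F l)"
    unfolding overlap_index_def by (rule if_P)
  moreover have "(LEAST l. l \<in> {1..vF F} \<and> overlap_prop F l) \<in> {1..vF F} \<and>
      overlap_prop F (LEAST l. l \<in> {1..vF F} \<and> overlap_prop F l)"
    by (rule LeastI_ex) (use True in blast)
  ultimately show ?thesis using that(1) by simp
next
  case False
  then have "overlap_index F = vF F + 1"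
    unfolding overlap_index_def by (rule if_not_P)
  then show ?thesis by (rule that(2))
qed

lemma overlap_index_le: "overlap_index F \<le> vF F + 1"
  by (cases rule: overlap_index_cases[of F]) auto

text \<open>Two copies glued at a single vertex share no edge, since an edge has at least two
  vertices.\<close>

lemma not_overlap_prop_1:
  assumes "is_rgraph r F" "r \<ge> 2" "F \<noteq> {}"
  shows "\<not> overlap_prop F 1"
proof
  assume *: "overlap_prop F 1"
  have fin: "finite (verts F)" using finite_verts assms by simp
  obtain e0 where "e0 \<in> F" using assms by auto
  moreover from this have "e0 \<noteq> {}" using assms by (auto simp: is_rgraph_def)
  ultimately obtain v where v: "v \<in> verts F" by (auto simp: verts_def)
  \<comment> \<open>Fixes \<open>v\<close> and pushes every other vertex beyond
    \<open>verts F\<close>, so the identity copy and this one meet only in \<open>v\<close>.\<close>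
  define \<psi> where "\<psi> = (\<lambda>x. if x = v then v else x + Max (verts F) + 1)"
  have "v \<le> Max (verts F)" using v fin by simp
  then have inj: "inj_on \<psi> (verts F)" by (auto simp: inj_on_def \<psi>_def)
  have "v \<in> id ` verts F \<inter> \<psi> ` verts F" using v by (auto simp: \<psi>_def)
  then have "card (id ` verts F \<inter> \<psi> ` verts F) \<noteq> 0"
    using fin by (metis card_0_eq empty_iff finite_Int finite_imageI)
  then have "card (id ` verts F \<inter> \<psi> ` verts F) \<ge> 1" by linarith
  with * inj obtain e e' where e: "e \<in> F" "e' \<in> F" "id ` e = \<psi> ` e'"
    unfolding overlap_prop_def by (meson inj_on_id)
  have "\<not> e' \<subseteq> {v}"
  proof
    assume "e' \<subseteq> {v}"
    then have "card e' \<le> 1" using card_mono[of "{v}" e'] by simp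
    then show False using e(2) assms by (auto simp: is_rgraph_def)
  qed
  then obtain x where x: "x \<in> e'" "x \<noteq> v" by auto
  then have "\<psi> x \<in> e" using e(3) by auto
  then have "\<psi> x \<le> Max (verts F)" using e(1) fin by (intro Max_ge) (auto simp: verts_def)
  then show False using x by (simp add: \<psi>_def)
qed

text \<open>Makes the subtractions in the exponents \<open>overlap_index F - 2\<close> and
  \<open>overlap_index F - 1\<close> exact and the latter positive. For the default value
  \<open>vF F + 1\<close>, a single edge already gives enough vertices.\<close>

lemma overlap_index_ge_2:
  assumes "is_rgraph r F" "r \<ge> 2" "F \<noteq> {}"
  shows "overlap_index F \<ge> 2"
proof (cases rule: overlap_index_cases[of F])
  case 1
  moreover from this have "overlap_index F \<noteq> 1" using not_overlap_prop_1[OF assms] by metis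
  ultimately show ?thesis by simp
next
  case 2
  obtain e where e: "e \<in> F" using assms by auto
  then have "card e \<le> vF F"
    using finite_verts[of r F] assms unfolding vF_def
    by (intro card_mono) (auto simp: verts_def)
  then show ?thesis using 2 e assms by (auto simp: is_rgraph_def)
qed

text \<open>Copies with a larger overlap would share an edge by the overlap property. For the
  default value the bound is \<open>vF F\<close>, the size of a copy.\<close>

lemma disjoint_copies_overlap:
  assumes "is_rgraph r F" "r > 0" and C: "is_copy F C" and D: "is_copy F D" and CD: "C \<inter> D = {}"
  shows "card (verts C \<inter> verts D) \<le> overlap_index F - 1"
proof (cases rule: overlap_index_cases[of F])
  case 1
  obtain \<phi> where \<phi>: "inj_on \<phi> (verts F)" "C = (`) \<phi> ` F" using C by (auto simp: is_copy_def)
  obtain \<psi> where \<psi>: "inj_on \<psi> (verts F)" "D = (`) \<psi> ` F" using D by (auto simp: is_copy_def)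
  have "\<not> overlap_index F \<le> card (verts C \<inter> verts D)"
  proof
    assume "overlap_index F \<le> card (verts C \<inter> verts D)"
    then obtain e e' where "e \<in> F" "e' \<in> F" "\<phi> ` e = \<psi> ` e'"
      using 1(2) \<phi> \<psi> unfolding overlap_prop_def verts_image \<phi>(2) \<psi>(2) by meson
    then show False using CD \<phi> \<psi> by auto
  qed
  then show ?thesis by simp
next
  case 2
  have "finite (verts C)"
    using C finite_verts[OF assms(1,2)] by (auto simp: is_copy_def verts_image)
  then have "card (verts C \<inter> verts D) \<le> vF F"
    unfolding card_verts_copy[OF C, symmetric] by (intro card_mono) auto
  then show ?thesis using 2 by simp
qed

section \<open>Maximal families of edge-disjoint copies\<close>

text \<open>Deleting all edges of an inclusion-maximal edge-disjoint family leaves no copy, since a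
  remaining one could be added to the family. The deletion costs at most \<open>card F\<close> edges
  per member.\<close>

lemma many_edge_disjoint_copies:
  assumes "rgraph_on r n G" "finite F" "F \<noteq> {}"
  obtains \<C> where "\<C> \<subseteq> Pow G" "\<And>C. C \<in> \<C> \<Longrightarrow> is_copy F C" "pairwise disjnt \<C>"
    "dist_free r n F G \<le> card \<C> * card F"
proof -
  define \<A> where "\<A> = {\<C>. \<C> \<subseteq> {C. C \<subseteq> G \<and> is_copy F C} \<and> pairwise disjnt \<C>}"
  have finG: "finite G" using assms(1) by (rule rgraph_on_finite)
  have "\<A> \<subseteq> Pow (Pow G)" by (auto simp: \<A>_def)
  then have "finite \<A>" using finG by (meson finite_Pow_iff finite_subset)
  moreover have "{} \<in> \<A>" by (simp add: \<A>_def)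
  ultimately obtain \<C> where \<C>: "\<C> \<in> \<A>" and max: "\<And>\<D>. \<D> \<in> \<A> \<Longrightarrow> \<C> \<subseteq> \<D> \<Longrightarrow> \<C> = \<D>"
    using finite_has_maximal[of \<A>] by blast
  define H where "H = G - \<Union>\<C>"
  have free: "F_free F H"
    unfolding F_free_def contains_copy_iff
  proof safe
    fix C assume C: "C \<subseteq> H" "is_copy F C"
    then have "insert C \<C> \<in> \<A>"
      using \<C> by (auto simp: \<A>_def H_def pairwise_insert disjnt_def)
    then have "C \<in> \<C>" using max[of "insert C \<C>"] by auto
    \<comment> \<open>As a member of \<open>\<C>\<close>, all edges of \<open>C\<close> were
      removed, yet \<open>C\<close> lies in \<open>H\<close>.\<close>
    then have "C = {}" using C(1) by (auto simp: H_def)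
    then show False using C(2) assms(3) by (auto simp: is_copy_def)
  qed
  have "rgraph_on r n H" using assms(1) by (auto simp: rgraph_on_def H_def)
  with free have "dist_free r n F G \<le> card (G - H \<union> (H - G))"
    unfolding dist_free_def by (intro Least_le) auto
  also have "G - H \<union> (H - G) = \<Union>\<C>" using \<C> by (auto simp: H_def \<A>_def)
  also have "card (\<Union>\<C>) \<le> (\<Sum>C\<in>\<C>. card C)"
    by (rule card_Union_le_sum_card)
  also have "\<dots> \<le> (\<Sum>C\<in>\<C>. card F)"
    using \<C> assms(2) by (intro sum_mono) (auto simp: \<A>_def is_copy_def intro: card_image_le)
  finally have "dist_free r n F G \<le> card \<C> * card F" by simp
  then show ?thesis using \<C> that[of \<C>] by (auto simp: \<A>_def)
qed

text \<open>Disjoint copies through a vertex use distinct edges at that vertex, as no vertex of \<open>F\<close> is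
  isolated.\<close>
lemma card_disjoint_through_vertex:
  assumes "finite G" "\<C> \<subseteq> Pow G" "pairwise disjnt \<C>"
  shows "card {C\<in>\<C>. v \<in> verts C} \<le> vdeg G v"
proof -
  define h where "h = (\<lambda>C. SOME e. e \<in> C \<and> v \<in> e)"
  have h: "h C \<in> C \<and> v \<in> h C" if "v \<in> verts C" for C
  proof -
    have "\<exists>e. e \<in> C \<and> v \<in> e" using that by (auto simp: verts_def)
    from someI_ex[OF this] show ?thesis unfolding h_def .
  qed
  have "inj_on h {C\<in>\<C>. v \<in> verts C}"
  proof (rule inj_onI)
    fix C D assume CD: "C \<in> {C\<in>\<C>. v \<in> verts C}" "D \<in> {C\<in>\<C>. v \<in> verts C}" "h C = h D"
    then have "h C \<in> C \<inter> D" using h[of C] h[of D] by auto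
    then show "C = D" using assms(3) CD by (auto simp: pairwise_def disjnt_def)
  qed
  moreover have "h ` {C\<in>\<C>. v \<in> verts C} \<subseteq> {e\<in>G. v \<in> e}" using h assms(2) by fastforce
  ultimately show ?thesis unfolding vdeg_def using assms(1) by (intro card_inj_on_le) auto
qed

text \<open>Union bound over the vertices of \<open>U\<close>. With \<open>U\<close> the vertex set
  of one copy, this gives the parameter \<open>D = vF F * \<Delta>\<close> of the second moment
  bound.\<close>

lemma card_disjoint_meeting:
  assumes "finite G" "\<C> \<subseteq> Pow G" "pairwise disjnt \<C>" "finite U"
    and "\<And>v. v \<in> U \<Longrightarrow> vdeg G v \<le> \<Delta>"
  shows "card {D\<in>\<C>. U \<inter> verts D \<noteq> {}} \<le> card U * \<Delta>"
proof -
  have "finite \<C>" using assms(1,2) by (meson finite_Pow_iff finite_subset)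
  then have "card {D\<in>\<C>. U \<inter> verts D \<noteq> {}} \<le> card (\<Union>v\<in>U. {D\<in>\<C>. v \<in> verts D})"
    using assms(4) by (intro card_mono) auto
  also have "\<dots> \<le> (\<Sum>v\<in>U. card {D\<in>\<C>. v \<in> verts D})"
    using assms(4) by (rule card_UN_le)
  also have "\<dots> \<le> (\<Sum>v\<in>U. \<Delta>)"
    using assms card_disjoint_through_vertex by (intro sum_mono) (meson order_trans)
  finally show ?thesis by simp
qed

lemma verts_subset: "rgraph_on r n G \<Longrightarrow> C \<subseteq> G \<Longrightarrow> verts C \<subseteq> {..<n}"
  by (auto simp: rgraph_on_def verts_def)

lemma vdeg_le_max_degree: "v < n \<Longrightarrow> vdeg G v \<le> max_degree n G"
  unfolding max_degree_def by (intro Max_ge) auto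

text \<open>The second moment bound for the vertex sets of a maximal edge-disjoint family, with
  \<open>k = vF F\<close> and \<open>s = overlap_index F - 1\<close>.\<close>

lemma prob_random_subset_spans_no_copy:
  assumes F: "is_rgraph r F" "r \<ge> 2" "F \<noteq> {}" and G: "rgraph_on r n G"
    and N: "real (dist_free r n F G) / real (card F) \<ge> N" "N > 0" and p: "0 < p" "p \<le> 1"
  shows "measure_pmf.prob (random_subset {..<n} p) {S. \<nexists>C. C \<subseteq> G \<and> is_copy F C \<and> verts C \<subseteq> S} \<le>
    1 / (N * p ^ vF F) + real (vF F * max_degree n G) / (N * p ^ (overlap_index F - 1))"
proof -
  have finF: "finite F" and finG: "finite G"
    using F G by (auto simp: is_rgraph_def rgraph_on_finite)
  obtain \<C> where \<C>: "\<C> \<subseteq> Pow G" "\<And>C. C \<in> \<C> \<Longrightarrow> is_copy F C" "pairwise disjnt \<C>"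
    "dist_free r n F G \<le> card \<C> * card F"
    using many_edge_disjoint_copies[OF G finF F(3)] by blast
  have "card F > 0" using finF F(3) by (simp add: card_gt_0_iff)
  moreover have "real (dist_free r n F G) \<le> card \<C> * card F"
    using \<C>(4) by (simp flip: of_nat_mult)
  ultimately have "real (dist_free r n F G) / card F \<le> card \<C>" by (simp add: divide_le_eq)
  then have NC: "N \<le> card \<C>" using N by linarith
  have vs: "verts C \<subseteq> {..<n}" if "C \<in> \<C>" for C
    using that \<C>(1) by (intro verts_subset[OF G]) auto
  have "measure_pmf.prob (random_subset {..<n} p) {S. \<nexists>C. C \<subseteq> G \<and> is_copy F C \<and> verts C \<subseteq> S} \<le>
      measure_pmf.prob (random_subset {..<n} p) {S. \<forall>C\<in>\<C>. \<not> verts C \<subseteq> S}"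
    using \<C> by (intro measure_pmf.finite_measure_mono) auto
  also have "\<dots> \<le> 1 / (real (card \<C>) * p ^ vF F) +
      real (vF F * max_degree n G) / (real (card \<C>) * p ^ (overlap_index F - 1))"
  proof (rule prob_random_subset_contains_none)
    show "finite \<C>" using \<C>(1) finG by (meson finite_Pow_iff finite_subset)
    show "\<C> \<noteq> {}" using NC N by auto
    show "card (verts C \<inter> verts D) \<le> overlap_index F - 1" if "C \<in> \<C>" "D \<in> \<C>" "C \<noteq> D" for C D
      using that F \<C>(2,3) by (intro disjoint_copies_overlap[of r]) (auto simp: pairwise_def disjnt_def)
    show "overlap_index F - 1 \<le> vF F" using overlap_index_le[of F] by simp
    show "card {D\<in>\<C>. verts C \<inter> verts D \<noteq> {}} \<le> vF F * max_degree n G" if "C \<in> \<C>" for C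
    proof -
      have "card {D\<in>\<C>. verts C \<inter> verts D \<noteq> {}} \<le> card (verts C) * max_degree n G"
        using vs[OF that] finG \<C> by (intro card_disjoint_meeting[of G])
          (auto intro: finite_subset vdeg_le_max_degree)
      then show ?thesis using card_verts_copy[OF \<C>(2)[OF that]] by simp
    qed
  qed (use p vs card_verts_copy[OF \<C>(2)] in auto)
  \<comment> \<open>The bound decreases in the size of the family, so a lower estimate
    \<open>N\<close> of that size suffices.\<close>
  also have "\<dots> \<le> 1 / (N * p ^ vF F) + real (vF F * max_degree n G) / (N * p ^ (overlap_index F - 1))"
    using NC N p by (intro add_mono divide_left_mono mult_right_mono mult_pos_pos) auto
  finally show ?thesis .
qed

section \<open>The tester\<close>

text \<open>\<open>E\<close> accumulates the edges found. The verdict is delayed to the end, so the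
  number of queries does not depend on the answers.\<close>

fun query_all :: "nat set set \<Rightarrow> nat set list \<Rightarrow> nat set set \<Rightarrow> qalg" where
  "query_all F [] E = (if contains_copy F E then Reject else Accept)"
| "query_all F (S # Ss) E = VQuery S (\<lambda>b. query_all F Ss (if b then insert S E else E))"

lemma run_query_all: "run (query_all F Ss E) G ord \<longleftrightarrow> \<not> contains_copy F (E \<union> (set Ss \<inter> G))"
  by (induction Ss arbitrary: E) auto

lemma nqueries_query_all: "nqueries (query_all F Ss E) G ord = length Ss"
  by (induction Ss arbitrary: E) auto

definition examine :: "nat \<Rightarrow> nat set set \<Rightarrow> nat set \<Rightarrow> qalg" where
  "examine r F S = query_all F (SOME Ss. set Ss = {e. e \<subseteq> S \<and> card e = r} \<and> distinct Ss) {}"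

lemma examine_list:
  fixes r :: nat
  assumes "finite S"
  defines "Ss \<equiv> SOME Ss. set Ss = {e. e \<subseteq> S \<and> card e = r} \<and> distinct Ss"
  shows "set Ss = {e. e \<subseteq> S \<and> card e = r}" "distinct Ss"
proof -
  have "finite {e. e \<subseteq> S \<and> card e = r}" using assms(1) by simp
  then have "\<exists>Ss. set Ss = {e. e \<subseteq> S \<and> card e = r} \<and> distinct Ss"
    by (rule finite_distinct_list)
  then have "set Ss = {e. e \<subseteq> S \<and> card e = r} \<and> distinct Ss"
    unfolding Ss_def by (rule someI_ex)
  then show "set Ss = {e. e \<subseteq> S \<and> card e = r}" "distinct Ss" by auto
qed

lemma run_examine:
  assumes "finite S" "rgraph_on r n G"
  shows "run (examine r F S) G ord \<longleftrightarrow> \<not> (\<exists>C. C \<subseteq> G \<and> is_copy F C \<and> verts C \<subseteq> S)"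
proof -
  have "C \<subseteq> {e. e \<subseteq> S \<and> card e = r} \<inter> G \<longleftrightarrow> C \<subseteq> G \<and> verts C \<subseteq> S" for C
    using assms(2) by (auto simp: verts_def rgraph_on_def)
  then show ?thesis
    using examine_list[OF assms(1), of r]
    by (auto simp: examine_def run_query_all contains_copy_iff)
qed

lemma nqueries_examine:
  assumes "finite S"
  shows "nqueries (examine r F S) G ord \<le> card S ^ r"
proof -
  have "nqueries (examine r F S) G ord = card {e. e \<subseteq> S \<and> card e = r}"
    unfolding examine_def nqueries_query_all
    using distinct_card[OF examine_list(2)[OF assms, of r]] examine_list(1)[OF assms, of r] by argo
  also have "\<dots> = card S choose r" by (rule n_subsets[OF assms])
  also have "\<dots> \<le> card S ^ r"
    using binomial_le_pow[of r "card S"] by (cases "r \<le> card S") (auto simp: binomial_eq_0)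
  finally show ?thesis .
qed

text \<open>\<open>s\<close> is the expected sample size; if it reaches \<open>n\<close>, the whole
  graph is examined. By Markov's inequality the cutoff \<open>6 * s\<close> discards a sample with
  probability at most 1/6.\<close>

definition sampling_tester :: "nat \<Rightarrow> nat set set \<Rightarrow> nat \<Rightarrow> real \<Rightarrow> qalg pmf" where
  "sampling_tester r F n s =
    (if real n \<le> s then return_pmf (examine r F {..<n})
     else map_pmf (\<lambda>S. if real (card S) < 6 * s then examine r F S else Accept)
       (random_subset {..<n} (s / real n)))"

lemma query_bounded_sampling_tester:
  assumes "s \<ge> 0"
  shows "query_bounded r n d \<Delta> (sampling_tester r F n s) ((6 * s) ^ r)"
proof -
  have examine: "real (nqueries (examine r F S) G ord) \<le> (6 * s) ^ r"
    if "finite S" "real (card S) \<le> 6 * s" for S G ord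
  proof -
    have "real (nqueries (examine r F S) G ord) \<le> real (card S) ^ r"
      using nqueries_examine[OF that(1), of r F G ord] by (simp flip: of_nat_power)
    also have "\<dots> \<le> (6 * s) ^ r" using that(2) by (intro power_mono) auto
    finally show ?thesis .
  qed
  note fin = finite_random_subset[OF finite_lessThan]
  show ?thesis
  proof (cases "real n \<le> s")
    case True
    then show ?thesis
      using examine[of "{..<n}"] assms by (simp add: query_bounded_def sampling_tester_def)
  next
    case False
    then show ?thesis
      using examine fin assms by (auto simp: query_bounded_def sampling_tester_def)
  qed
qed

text \<open>The error is one-sided: a rejection always exhibits a copy.\<close>

lemma sampling_tester_accepts_free:
  assumes "rgraph_on r n G" "F_free F G"
  shows "accept_prob (sampling_tester r F n s) G ord = 1"
proof -
  have run: "run (examine r F S) G ord" if "finite S" for S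
    using assms(2) run_examine[OF that assms(1)] by (auto simp: F_free_def contains_copy_iff)
  note fin = finite_random_subset[OF finite_lessThan]
  have "\<forall>A\<in>set_pmf (sampling_tester r F n s). run A G ord"
    using run fin by (auto simp: sampling_tester_def)
  then show ?thesis
    unfolding accept_prob_def by (subst measure_pmf.prob_eq_1) (auto simp: AE_measure_pmf_iff)
qed

text \<open>The error budget is 1/6 for an oversized sample and 1/12 for each of the two second
  moment terms, whence the constants 12 in the hypotheses.\<close>

lemma sampling_tester_rejects_far:
  assumes F: "is_rgraph r F" "r \<ge> 2" "F \<noteq> {}" and G: "rgraph_on r n G"
    and N: "real (dist_free r n F G) / real (card F) \<ge> N" "N > 0" and s: "s > 0"
    and large: "s < real n \<Longrightarrow> N * (s / real n) ^ vF F \<ge> 12"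
      "s < real n \<Longrightarrow>
        N * (s / real n) ^ (overlap_index F - 1) \<ge> 12 * real (vF F * max_degree n G)"
  shows "accept_prob (sampling_tester r F n s) G ord \<le> 1 / 3"
proof (cases "real n \<le> s")
  case True
  have "\<not> F_free F G"
  proof
    assume "F_free F G"
    then have "dist_free r n F G \<le> 0"
      unfolding dist_free_def using G by (intro Least_le exI[of _ G]) auto
    then show False using N by simp
  qed
  then obtain C where "C \<subseteq> G" "is_copy F C" by (auto simp: F_free_def contains_copy_iff)
  then have "\<not> run (examine r F {..<n}) G ord"
    using run_examine[OF _ G, of "{..<n}"] verts_subset[OF G] by auto
  then show ?thesis using True by (simp add: sampling_tester_def accept_prob_def)
next
  case False
  define p where "p = s / real n"
  have p: "0 < p" "p \<le> 1" using False s by (auto simp: p_def)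
  let ?M = "random_subset {..<n} p"
  let ?bad = "{S. \<nexists>C. C \<subseteq> G \<and> is_copy F C \<and> verts C \<subseteq> S}"
  have "accept_prob (sampling_tester r F n s) G ord =
      measure_pmf.prob ?M {S. run (if real (card S) < 6 * s then examine r F S else Accept) G ord}"
    using False by (simp add: accept_prob_def sampling_tester_def p_def vimage_def)
  also have "\<dots> \<le> measure_pmf.prob ?M ({S. 6 * s \<le> real (card S)} \<union> ?bad)"
  \<comment> \<open>The behaviour of \<open>examine\<close> is known only for finite
    \<open>S\<close>, so the inclusion is shown almost surely.\<close>
  proof (rule measure_pmf.finite_measure_mono_AE, rule AE_pmfI)
    fix S assume "S \<in> set_pmf ?M"
    then have "finite S" by (rule finite_random_subset[OF finite_lessThan])
    from run_examine[OF this G, of F ord] show "S \<in> {S. run (if real (card S) < 6 * s then examine r F S else Accept) G ord} \<longrightarrow>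
        S \<in> {S. 6 * s \<le> real (card S)} \<union> ?bad"
      by (cases "real (card S) < 6 * s") simp_all
  qed auto
  also have "\<dots> \<le> measure_pmf.prob ?M {S. 6 * s \<le> real (card S)} + measure_pmf.prob ?M ?bad"
    by (rule measure_Un_le) auto
  also have "measure_pmf.prob ?M {S. 6 * s \<le> real (card S)} \<le> real (card {..<n}) * p / (6 * s)"
    using p s by (intro prob_random_subset_card_ge) auto
  also have "\<dots> = 1 / 6" using False s by (simp add: p_def)
  also have "measure_pmf.prob ?M ?bad \<le> 1 / (N * p ^ vF F) +
      real (vF F * max_degree n G) / (N * p ^ (overlap_index F - 1))"
    by (rule prob_random_subset_spans_no_copy[OF F G N p])
  also have "1 / (N * p ^ vF F) \<le> 1 / 12"
    using large(1) False by (intro divide_left_mono) (auto simp: p_def)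
  also have "real (vF F * max_degree n G) / (N * p ^ (overlap_index F - 1)) \<le> 1 / 12"
    using large(2) False p N by (simp add: divide_le_eq p_def)
  finally show ?thesis by simp
qed

theorem theorem4p8:
  fixes \<epsilon> :: real and r :: nat and F :: "nat set set"
  assumes "\<epsilon> > 0" and "r \<ge> 2" and "is_rgraph r F" and "F \<noteq> {}"
  shows "\<exists>C::real. \<forall>n::nat. \<forall>d::real. \<forall>\<Delta>::nat. d > 0 \<longrightarrow>
    (\<exists>T. eps_tester r F \<epsilon> n d \<Delta> T \<and>
      query_bounded r n d \<Delta> T
        (C * max ((real n / (real n * d) powr (1 / real (vF F))) ^ r)
                 ((real n ^ (overlap_index F - 2) * real \<Delta> / d)
                    powr (real r / real (overlap_index F - 1)))))"
proof -
  define l where "l = overlap_index F"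
  \<comment> \<open>A far graph has \<open>card G = n d / r\<close> edges, hence at least
    \<open>a * (n * d)\<close> edge-disjoint copies.\<close>
  define a where "a = \<epsilon> / (real r * real (card F))"
  \<comment> \<open>Makes \<open>a * c\<close> reach both thresholds of the rejection lemma;
    \<open>c \<ge> 1\<close> gives \<open>c \<le> c ^ k\<close> for positive
    \<open>k\<close>.\<close>
  define c where "c = max 1 (12 * real (vF F) / a)"
  have l: "2 \<le> l" "l \<le> vF F + 1"
    using overlap_index_ge_2 overlap_index_le assms unfolding l_def by auto
  have cF: "card F > 0" using assms by (auto simp: is_rgraph_def card_gt_0_iff)
  have a: "a > 0" using assms cF by (simp add: a_def)
  have c: "c \<ge> 1" "a * c \<ge> 12 * vF F" "a * c \<ge> 12"
  proof -
    show "c \<ge> 1" by (simp add: c_def)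
    have "12 * real (vF F) / a \<le> c" by (simp add: c_def)
    then show "a * c \<ge> 12 * vF F" using a by (simp add: divide_le_eq mult.commute)
    moreover have "real (vF F) \<ge> 1" using l by simp
    ultimately show "a * c \<ge> 12" by linarith
  qed
  show ?thesis
  \<comment> \<open>The tester runs with \<open>s = c * M\<close>, and \<open>(6 * s) ^ r\<close>
    bounds its queries.\<close>
  proof (intro exI[of _ "(6 * c) ^ r"] allI impI)
    fix n :: nat and d :: real and \<Delta> :: nat
    assume d: "d > 0"
    \<comment> \<open>For nonempty inputs, \<open>M1\<close> and \<open>M2\<close> are the sample
      sizes \<open>m\<close> solving \<open>n d (m / n) ^ vF F = 1\<close> and
      \<open>n d (m / n) ^ (l - 1) = \<Delta>\<close>. Their \<open>r\<close>-th powers are the two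
      terms of the maximum.\<close>
    define M1 where "M1 = real n / (real n * d) powr (1 / real (vF F))"
    define B where "B = real n ^ (l - 2) * real \<Delta> / d"
    define M2 where "M2 = B powr (1 / real (l - 1))"
    define M where "M = max M1 M2"
    have B: "B \<ge> 0" using d by (simp add: B_def)
    \<comment> \<open>For \<open>B = 0\<close> both sides vanish only because \<open>k\<close> is
      positive: \<open>0 ^ 0\<close> is 1, but \<open>0 powr 0\<close> is 0.\<close>
    have M2_pow: "M2 ^ k = B powr (real k / real (l - 1))" if "k > 0" for k
    proof (cases "B = 0")
      case False
      then have "M2 > 0" using B by (simp add: M2_def)
      then have "M2 ^ k = M2 powr real k" by (simp add: powr_realpow)
      then show ?thesis by (simp add: M2_def powr_powr)
    qed (use that in \<open>simp add: M2_def\<close>)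
    have M0: "M1 \<ge> 0" "M2 \<ge> 0" "M \<ge> M1" "M \<ge> M2" "M \<ge> 0"
      by (auto simp: M1_def M2_def M_def le_max_iff_disj)
    have "M ^ r \<le> max (M1 ^ r) (M2 ^ r)" by (auto simp: M_def max_def)
    then have bound: "(6 * (c * M)) ^ r \<le> (6 * c) ^ r * max (M1 ^ r) (B powr (real r / real (l - 1)))"
      using c M2_pow[of r] assms(2)
      by (simp add: power_mult_distrib mult.assoc)
    have query: "query_bounded r n d \<Delta> (sampling_tester r F n (c * M))
        ((6 * c) ^ r * max (M1 ^ r) (B powr (real r / real (l - 1))))"
      using query_bounded_sampling_tester[of "c * M" r n d \<Delta> F] bound c M0
      unfolding query_bounded_def by (smt (verit) mult_nonneg_nonneg)
    have reject: "accept_prob (sampling_tester r F n (c * M)) G ord \<le> 1 / 3"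
      if G: "rgraph_on r n G" "avg_degree r n G = d" "max_degree n G = \<Delta>"
        and far: "\<epsilon> * real (card G) \<le> real (dist_free r n F G)" for G ord
    proof -
      \<comment> \<open>Division by zero would make the average degree 0.\<close>
      have n: "n > 0" using G(2) d by (cases "n = 0") (auto simp: avg_degree_def)
      have nd: "real n * d > 0" using n d by simp
      have cG: "real (card G) = real n * d / real r"
        using G(2) n assms(2) by (auto simp: avg_degree_def field_simps)
      define N where "N = a * (real n * d)"
      have N0: "N > 0" using a nd by (simp add: N_def)
      have N: "N \<le> real (dist_free r n F G) / real (card F)"
        using far cF unfolding cG N_def a_def by (simp add: field_simps)
      have M1: "M1 > 0" using n d by (simp add: M1_def)
      have M1_pow: "(M1 / real n) ^ vF F = 1 / (real n * d)"
      proof -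
        have "M1 / real n = (real n * d) powr (- (1 / real (vF F)))"
          using n by (simp add: M1_def powr_minus_divide)
        then have "(M1 / real n) ^ vF F = (real n * d) powr (- (1 / real (vF F)) * real (vF F))"
          using nd n d by (simp add: powr_powr flip: powr_realpow)
        also have "\<dots> = (real n * d) powr (- 1)" using l by simp
        finally show ?thesis using nd by (simp add: powr_minus_divide)
      qed
      have M2_pow': "(M2 / real n) ^ (l - 1) = real \<Delta> / (real n * d)"
      proof -
        obtain k where k: "l = Suc (Suc k)" using l by (metis add_2_eq_Suc le_Suc_ex)
        have "M2 ^ (l - 1) = B" using M2_pow[of "l - 1"] l B by simp
        then show ?thesis using n d k by (simp add: power_divide B_def field_simps)
      qed
      \<comment> \<open>One factor \<open>c\<close> survives from \<open>c ^ k\<close>, whatever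
        \<open>k\<close>. Thus the same \<open>c\<close> serves both thresholds, used with
        \<open>m = M1\<close> and \<open>m = M2\<close>.\<close>
      have scale: "a * c * ((real n * d) * (m / real n) ^ k) \<le> N * (c * M / real n) ^ k"
        if "k > 0" "0 \<le> m" "m \<le> M" for m k
      proof -
        have "c * (m / real n) ^ k \<le> c ^ k * (m / real n) ^ k"
          using that c by (intro mult_right_mono self_le_power) auto
        also have "\<dots> = (c * m / real n) ^ k" by (simp flip: power_mult_distrib)
        also have "\<dots> \<le> (c * M / real n) ^ k"
          using that c by (intro power_mono divide_right_mono mult_left_mono) auto
        finally have "N * (c * (m / real n) ^ k) \<le> N * (c * M / real n) ^ k"
          using N0 by (intro mult_left_mono) auto
        then show ?thesis by (simp add: N_def mult_ac)
      qed
      show ?thesis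
      proof (rule sampling_tester_rejects_far[OF assms(3,2,4) G(1) N N0])
        show "0 < c * M" using c M1 M0 by (intro mult_pos_pos) auto
        have "a * c \<le> N * (c * M / real n) ^ vF F"
          using scale[of "vF F" M1] l M0 M1_pow n d by simp
        then show "12 \<le> N * (c * M / real n) ^ vF F" using c(3) by linarith
        have "12 * real (vF F * \<Delta>) \<le> a * c * real \<Delta>"
          using mult_right_mono[OF c(2), of "real \<Delta>"] by simp
        also have "\<dots> \<le> N * (c * M / real n) ^ (l - 1)"
          using scale[of "l - 1" M2] l M0 M2_pow' n d by simp
        finally show "12 * real (vF F * max_degree n G) \<le>
            N * (c * M / real n) ^ (overlap_index F - 1)"
          by (simp add: G(3) l_def)
      qed
    qed
    have tester: "eps_tester r F \<epsilon> n d \<Delta> (sampling_tester r F n (c * M))"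
      unfolding eps_tester_def
    proof (intro allI impI conjI)
      fix G ord assume G: "in_class r n d \<Delta> G ord"
      then have G': "rgraph_on r n G" "avg_degree r n G = d" "max_degree n G = \<Delta>"
        by (auto simp: in_class_def)
      show "2 / 3 \<le> accept_prob (sampling_tester r F n (c * M)) G ord" if "F_free F G"
        using sampling_tester_accepts_free[OF G'(1) that] by simp
      \<comment> \<open>A larger distance parameter is a stronger assumption and reduces to
        \<open>\<epsilon>\<close>.\<close>
      fix \<epsilon>' assume "\<epsilon> \<le> \<epsilon>'" "eps_far r n F \<epsilon>' G"
      then have "\<epsilon> * real (card G) \<le> real (dist_free r n F G)"
        unfolding eps_far_def by (meson mult_right_mono of_nat_0_le_iff order_trans)
      then show "2 / 3 \<le> 1 - accept_prob (sampling_tester r F n (c * M)) G ord"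
        using reject[OF G', of ord] by simp
    qed
    show "\<exists>T. eps_tester r F \<epsilon> n d \<Delta> T \<and>
      query_bounded r n d \<Delta> T
        ((6 * c) ^ r * max ((real n / (real n * d) powr (1 / real (vF F))) ^ r)
                 ((real n ^ (overlap_index F - 2) * real \<Delta> / d)
                    powr (real r / real (overlap_index F - 1))))"
      using tester query unfolding M1_def B_def l_def by blast
  qed
qed

end
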